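(* Let $p$ be an $n$th degree complex polynomial and let its critical points take the form $$\alpha+\beta\cos\frac{k\pi}{n},\qquad k=1,\ldots,n-1,\qquad \beta\neq 0.$$ Then there is an inscribed ellipse interpolating the midpoints of the convex polygon formed by the roots of $p$, and the foci of this ellipse are the two most extreme critical points of $p$, namely $\alpha\pm\beta\cos\frac{\pi}{n}$.
   Context: Here $\alpha$ and $\beta$ are complex numbers, and the critical points of $p$ are the $n-1$ zeros of its derivative $p'$. The convex polygon formed by the roots of $p$ is the convex polygon in the complex plane with the roots of $p$ as its vertices. An inscribed ellipse interpolating the midpoints of a convex polygon is an ellipse inscribed in the polygon that is tangent to each side of the polygon at the midpoint of that side.
   Formalization: The roots of p are additionally assumed not to be collinear; otherwise (for example p = 4z³ − 3z, with roots 0, ±√3/2) no convex polygon with the roots as vertices exists. *)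

theory Defs
  imports "HOL-Analysis.Analysis" "HOL-Computational_Algebra.Polynomial"
begin

definition poly_roots :: "complex poly \<Rightarrow> complex set" where
  "poly_roots p = {z. poly p z = 0}"

definition critical_points :: "complex poly \<Rightarrow> complex set" where
  "critical_points p = poly_roots (pderiv p)"

text \<open>A convex polygon is a two-dimensional region, so collinear vertex sets are excluded.
  Every point of \<open>V\<close> has to be a genuine vertex (extreme point) of the region.\<close>

definition convex_polygon_with_vertices :: "complex set \<Rightarrow> complex set \<Rightarrow> bool" where
  "convex_polygon_with_vertices P V \<longleftrightarrow>
     finite V \<and> \<not> collinear V \<and> P = convex hull V \<and> {z. z extreme_point_of P} = V"

text \<open>The strict inequality excludes degenerate ellipses (segments and points);
  circles (\<open>f = g\<close>) are included.\<close>

definition ellipse_with_foci :: "complex set \<Rightarrow> complex \<Rightarrow> complex \<Rightarrow> bool" where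
  "ellipse_with_foci E f g \<longleftrightarrow> (\<exists>s > dist f g. E = {z. dist z f + dist z g = s})"

text \<open>\<open>L\<close> is the line through \<open>m\<close> in the direction of the nonzero velocity vector of
  a curve that runs inside \<open>E\<close> and passes through \<open>m\<close>.\<close>

definition tangent_line_at :: "complex set \<Rightarrow> complex set \<Rightarrow> complex \<Rightarrow> bool" where
  "tangent_line_at L E m \<longleftrightarrow>
     (\<exists>(c :: real \<Rightarrow> complex) v.
        range c \<subseteq> E \<and> c 0 = m \<and> (c has_vector_derivative v) (at 0) \<and> v \<noteq> 0 \<and>
        L = range (\<lambda>t::real. m + t *\<^sub>R v))"

text \<open>The sides of \<open>P\<close> are its one-dimensional faces; for a polygon each of them is a
  segment \<open>closed_segment a b\<close>.\<close>

definition midpoint_inscribed :: "complex set \<Rightarrow> complex set \<Rightarrow> bool" where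
  "midpoint_inscribed E P \<longleftrightarrow>
     E \<subseteq> P \<and>
     (\<forall>a b. closed_segment a b edge_of P \<longrightarrow>
        tangent_line_at (affine hull {a, b}) E (midpoint a b))"

end

theory Submission
  imports Defs
begin

text \<open>
  The cosines \<open>cos (k * pi / n)\<close> are the critical points of the Chebyshev polynomial \<open>T\<^sub>n\<close>. A polynomial
  of degree \<open>n\<close> with \<open>n - 1\<close> distinct critical points is determined by these up to a factor and an
  additive constant, so
  \<open>p (\<alpha> + \<beta> * w) = c * T\<^sub>n w + d\<close> (\<open>eq_chebyshev_if_same_critical_points\<close>). With the Joukowski map
  \<open>J z = (z + 1 / z) / 2\<close> one has \<open>T\<^sub>n (J z) = J (z ^ n)\<close>; therefore the roots of \<open>c * T\<^sub>n + d\<close> are the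
  points \<open>J (a * u)\<close>, where \<open>a\<close> is fixed and \<open>u\<close> runs through the \<open>n\<close>-th roots of unity
  (\<open>chebyshev_level_set\<close>). On the unit circle \<open>1 / u\<close> is the conjugate of \<open>u\<close>, so \<open>J (a * u)\<close> is a
  real-linear function of \<open>u\<close>: the roots of \<open>p\<close> are the vertices of an affine image of a regular
  \<open>n\<close>-gon (\<open>poly_roots_chebyshev_form\<close>). The map is injective unless \<open>norm a = 1\<close>, and in that case
  the roots are collinear.

  The incircle of the regular \<open>n\<close>-gon has radius \<open>r = cos (pi / n)\<close> and touches the sides at their
  midpoints. Affine maps preserve midpoints and tangency, so the image of the incircle is inscribed
  in the same way in the polygon of the roots (\<open>midpoint_inscribed_affine_image\<close>). The linear map takes
  the circle of radius \<open>r\<close> to \<open>r\<close> times the image of a circle about 0 under \<open>J\<close>, which is an ellipse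
  with foci \<open>\<plusminus>r\<close>. Thus the foci for \<open>p\<close> are \<open>\<alpha> \<plusminus> \<beta> * r\<close> (\<open>ellipse_joukowski_linear\<close>), and these are
  the critical points for \<open>k = 1\<close> and \<open>k = n - 1\<close>.
\<close>

section \<open>The Joukowski map and Chebyshev polynomials\<close>

definition joukowski :: "complex \<Rightarrow> complex" where
  "joukowski z = (z + 1 / z) / 2"

text \<open>The preimages of \<open>w\<close> are the roots of \<open>z\<^sup>2 - 2 * w * z + 1\<close>; their product is 1, so neither vanishes.\<close>

lemma joukowski_surj:
  obtains z where "z \<noteq> 0" "joukowski z = w"
proof
  define s where "s = csqrt (w\<^sup>2 - 1)"
  have s: "s\<^sup>2 = w\<^sup>2 - 1" by (simp add: s_def)
  have prod: "(w + s) * (w - s) = 1"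
    using s by (simp add: algebra_simps power2_eq_square)
  then show nz: "w + s \<noteq> 0" by auto
  have "1 / (w + s) = w - s" using nz prod by (simp add: field_simps)
  then show "joukowski (w + s) = w" by (simp add: joukowski_def)
qed

lemma joukowski_eq_cases:
  assumes "z \<noteq> 0" "w \<noteq> 0" "joukowski z = joukowski w"
  shows "z = w \<or> 1 / z = w"
proof -
  have "(z - w) * (z * w - 1) = z * w * ((z + 1 / z) - (w + 1 / w))"
    using assms by (simp add: field_simps)
  also have "z + 1 / z = w + 1 / w"
    using assms(3) unfolding joukowski_def by (simp only: divide_cancel_right) simp
  finally have "z = w \<or> z * w = 1" by simp
  then show ?thesis using assms(1) by (auto simp: field_simps)
qed

lemma joukowski_inverse: "joukowski (1 / z) = joukowski z"
  by (simp add: joukowski_def)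

text \<open>These factorizations are what makes \<open>\<plusminus>1\<close> the foci of the images of circles about 0.\<close>

lemma joukowski_diff_1: "z \<noteq> 0 \<Longrightarrow> joukowski z - 1 = (z - 1)\<^sup>2 / (2 * z)"
  and joukowski_add_1: "z \<noteq> 0 \<Longrightarrow> joukowski z + 1 = (z + 1)\<^sup>2 / (2 * z)"
  by (simp_all add: joukowski_def field_simps power2_eq_square)

lemma joukowski_cis: "joukowski (cis t) = complex_of_real (cos t)"
  by (simp add: joukowski_def complex_eq_iff Re_divide Im_divide)

fun chebyshev :: "nat \<Rightarrow> complex poly" where
  "chebyshev 0 = 1"
| "chebyshev (Suc 0) = [:0, 1:]"
| "chebyshev (Suc (Suc n)) = [:0, 2:] * chebyshev (Suc n) - chebyshev n"

lemma degree_chebyshev_le: "degree (chebyshev n) \<le> n"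
proof (induction n rule: chebyshev.induct)
  case (3 n)
  have "degree ([:0, 2:] * chebyshev (Suc n)) \<le> Suc (Suc n)"
    using degree_mult_le[of "[:0, 2:]" "chebyshev (Suc n)"] 3 by simp
  then show ?case using 3 by (auto intro!: degree_diff_le)
qed simp_all

text \<open>The complex form of \<open>T\<^sub>n (cos t) = cos (n * t)\<close>: the polynomial is semiconjugate, via the
  Joukowski map, to the power map.\<close>

lemma poly_chebyshev_joukowski:
  assumes "z \<noteq> 0"
  shows "poly (chebyshev n) (joukowski z) = joukowski (z ^ n)"
proof (induction n rule: chebyshev.induct)
  case (3 n)
  have "2 * joukowski z * joukowski (z ^ Suc n) - joukowski (z ^ n) = joukowski (z ^ Suc (Suc n))"
    using assms by (simp add: joukowski_def field_simps)
  then show ?case using 3 by (simp add: mult_ac)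
qed (simp_all add: joukowski_def)

lemma inj_on_cos_frac:
  assumes "n > 0"
  shows "inj_on (\<lambda>k::nat. complex_of_real (cos (real k * pi / real n))) {1..<n}"
proof (rule inj_onI)
  fix j k assume jk: "j \<in> {1..<n}" "k \<in> {1..<n}"
    "complex_of_real (cos (real j * pi / real n)) = complex_of_real (cos (real k * pi / real n))"
  have range: "0 \<le> real i * pi / real n" "real i * pi / real n \<le> pi" if "i \<in> {1..<n}" for i
    using that by (simp_all add: divide_simps)
  have "cos (real j * pi / real n) = cos (real k * pi / real n)"
    using jk(3) by (simp only: of_real_eq_iff)
  then have "real j * pi / real n = real k * pi / real n"
    using range[OF jk(1)] range[OF jk(2)] cos_inj_pi by blast
  then show "j = k" using assms by simp
qed

text \<open>Differentiating the semiconjugacy at \<open>z = cis (k * pi / n)\<close>: the power side has derivative 0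
  there because \<open>z ^ n = \<plusminus>1\<close> is critical for the Joukowski map, whereas \<open>z \<noteq> \<plusminus>1\<close> itself is not
  critical.\<close>

lemma poly_pderiv_chebyshev_cos:
  assumes "k \<in> {1..<n}"
  shows "poly (pderiv (chebyshev n)) (complex_of_real (cos (real k * pi / real n))) = 0"
proof -
  define z where "z = cis (real k * pi / real n)"
  have z0: "z \<noteq> 0" by (simp add: z_def)
  have zn: "z ^ n = cis (real k * pi)" using assms by (simp add: z_def Complex.DeMoivre)
  then have "(z ^ n)\<^sup>2 = cis (2 * pi * real k)"
    unfolding zn Complex.DeMoivre by (simp add: mult_ac)
  then have zn2: "(z ^ n)\<^sup>2 = 1" by (simp add: cis_multiple_2pi)
  have z2: "z\<^sup>2 \<noteq> 1"
  proof
    assume "z\<^sup>2 = 1"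
    then have "z = 1 \<or> z = -1" by (simp add: power2_eq_1_iff)
    then have "sin (real k * pi / real n) = 0" by (auto simp: z_def complex_eq_iff)
    moreover have "sin (real k * pi / real n) > 0"
      using assms by (intro sin_gt_zero) (auto simp: divide_simps)
    ultimately show False by simp
  qed
  have "((\<lambda>w. poly (chebyshev n) (joukowski w)) has_field_derivative
      poly (pderiv (chebyshev n)) (joukowski z) * ((1 - 1 / z\<^sup>2) / 2)) (at z)"
    unfolding joukowski_def using z0
    by (auto intro!: derivative_eq_intros simp: power2_eq_square field_simps)
  moreover have "((\<lambda>w. joukowski (w ^ n)) has_field_derivative
      (1 - 1 / (z ^ n)\<^sup>2) / 2 * (of_nat n * z ^ (n - 1))) (at z)"
    unfolding joukowski_def using z0
    by (auto intro!: derivative_eq_intros simp: power2_eq_square field_simps)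
  then have "((\<lambda>w. poly (chebyshev n) (joukowski w)) has_field_derivative
      (1 - 1 / (z ^ n)\<^sup>2) / 2 * (of_nat n * z ^ (n - 1))) (at z)"
    by (rule has_field_derivative_transform_within_open[where S = "- {0}"])
       (auto simp: z0 poly_chebyshev_joukowski)
  ultimately have "poly (pderiv (chebyshev n)) (joukowski z) * ((1 - 1 / z\<^sup>2) / 2) =
      (1 - 1 / (z ^ n)\<^sup>2) / 2 * (of_nat n * z ^ (n - 1))"
    by (rule DERIV_unique)
  then show ?thesis using zn2 z2 z0 by (simp add: z_def joukowski_cis)
qed

text \<open>The values at \<open>1\<close> and at \<open>cos (pi / n)\<close> are \<open>1\<close> and \<open>-1\<close>.\<close>

lemma pderiv_chebyshev_nonzero:
  assumes "n \<ge> 2"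
  shows "pderiv (chebyshev n) \<noteq> 0"
proof
  assume "pderiv (chebyshev n) = 0"
  then have "degree (chebyshev n) = 0" by (simp add: pderiv_eq_0_iff)
  then obtain c where c: "chebyshev n = [:c:]" by (rule degree_eq_zeroE)
  have "joukowski (cis 0 ^ n) = joukowski (cis (pi / n) ^ n)"
    by (metis c poly_chebyshev_joukowski cis_neq_zero poly_pCons poly_0 mult_zero_right add_0_right)
  moreover have "cis (pi / n) ^ n = -1" using assms by (simp add: Complex.DeMoivre)
  ultimately show False by (simp add: joukowski_def)
qed

text \<open>Both derivatives have degree at most \<open>n - 1\<close> and vanish at the same \<open>n - 1\<close> points. Choosing
  \<open>c\<close> to match them at one further point makes them equal up to the factor \<open>c\<close>.\<close>

lemma eq_chebyshev_if_same_critical_points: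
  fixes q :: "complex poly"
  assumes n: "n \<ge> 2" and deg: "degree q \<le> n" and q0: "pderiv q \<noteq> 0"
    and crit: "\<And>k. k \<in> {1..<n} \<Longrightarrow> poly (pderiv q) (complex_of_real (cos (real k * pi / real n))) = 0"
  obtains c d where "c \<noteq> 0" "q = smult c (chebyshev n) + [:d:]"
proof -
  define A where "A = (\<lambda>k::nat. complex_of_real (cos (real k * pi / real n))) ` {1..<n}"
  define T where "T = pderiv (chebyshev n)"
  define Q where "Q = pderiv q"
  have A: "finite A" "card A = n - 1"
    using card_image[OF inj_on_cos_frac[of n]] n by (auto simp: A_def)
  have zeros: "poly T x = 0" "poly Q x = 0" if "x \<in> A" for x
    using that crit poly_pderiv_chebyshev_cos[of _ n] by (auto simp: A_def T_def Q_def)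
  have degs: "degree T \<le> n - 1" "degree Q \<le> n - 1"
    using degree_chebyshev_le[of n] deg by (auto simp: T_def Q_def degree_pderiv)
  have vanish: "D = 0" if "degree D \<le> n - 1" "\<And>x. x \<in> A \<Longrightarrow> poly D x = 0"
      "poly D y = 0" "y \<notin> A" for D :: "complex poly" and y
  proof (rule poly_eqI_degree[where A = "insert y A"])
    show "poly D x = poly 0 x" if "x \<in> insert y A" for x
      using that \<open>\<And>x. x \<in> A \<Longrightarrow> poly D x = 0\<close> \<open>poly D y = 0\<close> by auto
  qed (use that A n in auto)
  obtain y where y: "poly Q y \<noteq> 0" using q0 poly_all_0_iff_0[of Q] by (auto simp: Q_def)
  then have yA: "y \<notin> A" using zeros by auto
  have Ty: "poly T y \<noteq> 0"
    using vanish[of T y] degs zeros yA pderiv_chebyshev_nonzero[OF n] by (auto simp: T_def)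
  define c where "c = poly Q y / poly T y"
  have "Q - smult c T = 0"
  proof (rule vanish[OF _ _ _ yA])
    show "degree (Q - smult c T) \<le> n - 1"
      using degs degree_smult_le[of c T] by (auto intro!: degree_diff_le)
  qed (use zeros Ty in \<open>auto simp: c_def\<close>)
  then have "pderiv (q - smult c (chebyshev n)) = 0"
    by (simp add: pderiv_diff pderiv_smult Q_def T_def)
  then obtain d where "q - smult c (chebyshev n) = [:d:]"
    using pderiv_eq_0_iff degree_eq_zeroE by blast
  then have "q = smult c (chebyshev n) + [:d:]" by (simp add: algebra_simps)
  moreover have "c \<noteq> 0" using y Ty by (simp add: c_def)
  ultimately show thesis using that by blast
qed

section \<open>Images of circles under the linearized Joukowski map\<close>

text \<open>On a circle about 0 the conjugate of \<open>u\<close> is a multiple of \<open>1 / u\<close>. Replacing one by the other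
  turns \<open>u \<mapsto> joukowski (a * u)\<close> into a map that is real-linear on the whole plane and agrees with it
  on the unit circle; on the circle of radius \<open>r\<close> the two differ by scaling.\<close>

definition joukowski_linear :: "complex \<Rightarrow> complex \<Rightarrow> complex" where
  "joukowski_linear a u = (a * u + cnj u / a) / 2"

lemma joukowski_linear_on_circle:
  assumes "norm u = r" "r > 0"
  shows "joukowski_linear a u = r * joukowski (a * (u / r))"
proof -
  from assms have "cnj u * u = r\<^sup>2" "u \<noteq> 0" using complex_norm_square[of u] by (auto simp: mult.commute)
  then have "cnj u = r\<^sup>2 / u" by (simp add: field_simps)
  then show ?thesis using \<open>u \<noteq> 0\<close> assms(2)
    by (cases "a = 0") (simp_all add: joukowski_linear_def joukowski_def field_simps power2_eq_square)
qed

lemma linear_joukowski_linear: "linear (\<lambda>u. b * joukowski_linear a u)"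
  by (rule linearI) (simp_all add: joukowski_linear_def scaleR_conv_of_real add_divide_distrib distrib_left mult_ac)

text \<open>On the kernel the two summands of the map have equal modulus, which forces \<open>norm a = 1\<close> or \<open>u = 0\<close>.\<close>

lemma inj_joukowski_linear:
  assumes "a \<noteq> 0" "b \<noteq> 0" "norm a \<noteq> 1"
  shows "inj (\<lambda>u. b * joukowski_linear a u)"
proof (subst linear_injective_0[OF linear_joukowski_linear], intro allI impI)
  fix u assume "b * joukowski_linear a u = 0"
  then have "a * u = - (cnj u / a)" using assms by (simp add: joukowski_linear_def add_eq_0_iff)
  then have "norm (a * u) = norm (cnj u / a)" by (metis norm_minus_cancel)
  then have "norm u * ((norm a)\<^sup>2 - 1) = 0"
    using assms(1) by (simp add: norm_mult norm_divide field_simps power2_eq_square)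
  moreover have "(norm a)\<^sup>2 \<noteq> 1" using assms(3) by (simp add: power2_eq_1_iff)
       (metis norm_ge_zero not_one_le_zero neg_0_le_iff_le)
  ultimately show "u = 0" by simp
qed

text \<open>Write \<open>C = joukowski (a ^ n)\<close> and \<open>w = joukowski x\<close>. The semiconjugacy gives \<open>x ^ n = a ^ n\<close> up to
  inverting \<open>x\<close>, which leaves \<open>w\<close> unchanged. So \<open>x / a\<close> is a root of unity.\<close>

lemma chebyshev_level_set:
  assumes "n > 0"
  obtains a where "a \<noteq> 0" "{w. poly (chebyshev n) w = C} = joukowski_linear a ` {u. u ^ n = 1}"
proof -
  obtain \<eta> where \<eta>: "\<eta> \<noteq> 0" "joukowski \<eta> = C" by (rule joukowski_surj)
  obtain a where a: "a ^ n = \<eta>"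
    using exists_complex_root[of n \<eta>] assms by auto
  then have a0: "a \<noteq> 0" using \<eta> assms by auto
  have unit: "joukowski_linear a u = joukowski (a * u)" "u \<noteq> 0" if "u ^ n = 1" for u
  proof -
    have "norm u = 1" using that assms power_eq_1_iff by blast
    then show "joukowski_linear a u = joukowski (a * u)" "u \<noteq> 0"
      using joukowski_linear_on_circle[of u 1 a] by auto
  qed
  have "w \<in> joukowski_linear a ` {u. u ^ n = 1}" if w: "poly (chebyshev n) w = C" for w
  proof -
    obtain y where y: "y \<noteq> 0" "joukowski y = w" by (rule joukowski_surj)
    have "joukowski (y ^ n) = joukowski \<eta>"
      using w y poly_chebyshev_joukowski[of y n] \<eta> by simp
    then have "y ^ n = \<eta> \<or> 1 / y ^ n = \<eta>"
      using y \<eta> by (intro joukowski_eq_cases) auto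
    then obtain x where x: "x \<noteq> 0" "x ^ n = \<eta>" "joukowski x = w"
    proof
      assume "1 / y ^ n = \<eta>"
      then show thesis using y by (intro that[of "1 / y"]) (auto simp: power_divide joukowski_inverse)
    qed (use y that in auto)
    have "(x / a) ^ n = 1" using x a \<eta> by (simp add: power_divide)
    moreover have "w = joukowski_linear a (x / a)" using unit[of "x / a"] \<open>(x / a) ^ n = 1\<close> x a0 by simp
    ultimately show ?thesis by blast
  qed
  moreover have "poly (chebyshev n) (joukowski_linear a u) = C" if "u ^ n = 1" for u
    using unit[OF that] a0 poly_chebyshev_joukowski[of "a * u" n] that a \<eta>
    by (simp add: power_mult_distrib)
  ultimately have "{w. poly (chebyshev n) w = C} = joukowski_linear a ` {u. u ^ n = 1}" by blast
  then show thesis using that a0 by blast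
qed

text \<open>Points of the image have the form \<open>\<alpha> + \<beta> * r * joukowski x\<close> with \<open>norm x = norm a\<close>. Their distances
  to the foci are proportional to \<open>norm (x - 1) ^ 2\<close> and \<open>norm (x + 1) ^ 2\<close>, and by the parallelogram
  law the sum depends on \<open>t = norm x\<close> only, through \<open>t + 1 / t\<close>. Conversely that number determines
  \<open>t\<close> up to inversion, and inverting \<open>x\<close> does not change \<open>joukowski x\<close>. Since \<open>t + 1 / t > 2\<close> for
  \<open>t \<noteq> 1\<close>, the ellipse is not degenerate.\<close>

lemma ellipse_joukowski_linear:
  assumes a: "a \<noteq> 0" "norm a \<noteq> 1" and b: "\<beta> \<noteq> 0" and r: "r > 0"
  shows "ellipse_with_foci ((\<lambda>u. \<alpha> + \<beta> * joukowski_linear a u) ` sphere 0 r)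
     (\<alpha> + \<beta> * complex_of_real r) (\<alpha> - \<beta> * complex_of_real r)"
proof -
  define h where "h t = t + 1 / t" for t :: real
  have h_cases: "x = y \<or> 1 / x = y" if "x > 0" "y > 0" "h x = h y" for x y
  proof -
    have "(x - y) * (x * y - 1) = x * y * (h x - h y)"
      using that by (simp add: h_def field_simps)
    then have "x = y \<or> x * y = 1" using that by simp
    then show ?thesis using that by (auto simp: field_simps)
  qed
  define s where "s = norm \<beta> * r * h (norm a)"
  have dist_sum: "dist z (\<alpha> + \<beta> * r) + dist z (\<alpha> - \<beta> * r) = norm \<beta> * r * h (norm x)"
    if "x \<noteq> 0" "z = \<alpha> + \<beta> * (r * joukowski x)" for x z
  proof -
    have "z - (\<alpha> + \<beta> * r) = \<beta> * r * (joukowski x - 1)"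
         "z - (\<alpha> - \<beta> * r) = \<beta> * r * (joukowski x + 1)"
      using that by (auto simp: algebra_simps)
    then have "dist z (\<alpha> + \<beta> * r) = norm \<beta> * r * ((norm (x - 1))\<^sup>2 / (2 * norm x))"
              "dist z (\<alpha> - \<beta> * r) = norm \<beta> * r * ((norm (x + 1))\<^sup>2 / (2 * norm x))"
      using that(1) r unfolding dist_norm
      by (simp_all add: joukowski_diff_1 joukowski_add_1 norm_mult norm_divide norm_power)
    then have "dist z (\<alpha> + \<beta> * r) + dist z (\<alpha> - \<beta> * r) =
        norm \<beta> * r * (((norm (x - 1))\<^sup>2 + (norm (x + 1))\<^sup>2) / (2 * norm x))"
      by (simp only: distrib_left add_divide_distrib)
    also have "(norm (x - 1))\<^sup>2 + (norm (x + 1))\<^sup>2 = 2 * ((norm x)\<^sup>2 + 1)"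
      unfolding cmod_power2 by (simp add: power2_eq_square algebra_simps)
    also have "2 * ((norm x)\<^sup>2 + 1) / (2 * norm x) = h (norm x)"
      using that by (simp add: h_def field_simps power2_eq_square)
    finally show ?thesis .
  qed
  have "z \<in> (\<lambda>u. \<alpha> + \<beta> * joukowski_linear a u) ` sphere 0 r"
    if z: "dist z (\<alpha> + \<beta> * r) + dist z (\<alpha> - \<beta> * r) = s" for z
  proof -
    obtain y where y: "y \<noteq> 0" "joukowski y = (z - \<alpha>) / (\<beta> * r)" by (rule joukowski_surj)
    have zy: "z = \<alpha> + \<beta> * (r * joukowski y)" using y b r by simp
    have "h (norm y) = h (norm a)"
      using dist_sum[OF y(1) zy] z b r by (simp add: s_def)
    then have "norm y = norm a \<or> 1 / norm y = norm a"
      using y a by (intro h_cases) auto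
    then obtain x where x: "x \<noteq> 0" "norm x = norm a" "joukowski x = joukowski y"
    proof
      assume "1 / norm y = norm a"
      then show thesis using y
        by (intro that[of "1 / y"]) (auto simp: norm_divide joukowski_inverse)
    qed (use y that in auto)
    define u where "u = r * x / a"
    have nu: "norm u = r" using x a r by (simp add: u_def norm_mult norm_divide)
    have "joukowski_linear a u = r * joukowski x"
      using joukowski_linear_on_circle[OF nu r] a r by (simp add: u_def)
    then have "z = \<alpha> + \<beta> * joukowski_linear a u" using zy x by simp
    then show ?thesis using nu by auto
  qed
  moreover have "dist z (\<alpha> + \<beta> * r) + dist z (\<alpha> - \<beta> * r) = s"
    if "norm u = r" "z = \<alpha> + \<beta> * joukowski_linear a u" for u z
    using dist_sum[of "a * (u / r)" z] that joukowski_linear_on_circle[OF that(1) r] a r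
    by (auto simp: s_def norm_mult norm_divide)
  ultimately have "(\<lambda>u. \<alpha> + \<beta> * joukowski_linear a u) ` sphere 0 r =
      {z. dist z (\<alpha> + \<beta> * r) + dist z (\<alpha> - \<beta> * r) = s}"
    by auto
  moreover have "dist (\<alpha> + \<beta> * r) (\<alpha> - \<beta> * r) < s"
  proof -
    have "h (norm a) - 2 = (norm a - 1)\<^sup>2 / norm a"
      using a by (simp add: h_def field_simps power2_eq_square)
    also have "\<dots> > 0" using a by simp
    finally have "norm \<beta> * r * 2 < s" using b r by (simp add: s_def)
    moreover have "dist (\<alpha> + \<beta> * r) (\<alpha> - \<beta> * r) = norm (2 * \<beta> * r)"
      by (simp add: dist_norm algebra_simps)
    ultimately show ?thesis using r by (simp add: norm_mult)
  qed
  ultimately show ?thesis unfolding ellipse_with_foci_def by blast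
qed

lemma cnj_unit: "norm u = 1 \<Longrightarrow> cnj u = 1 / u"
  by (simp add: complex_div_cnj[of 1 u])

text \<open>For \<open>norm a = 1\<close> the linear map is \<open>u \<mapsto> Re (a * u)\<close>, and the ellipse collapses to a segment.\<close>

lemma collinear_joukowski_linear_unit:
  assumes "norm a = 1"
  shows "collinear ((\<lambda>u. \<alpha> + \<beta> * joukowski_linear a u) ` U)"
proof -
  have "joukowski_linear a u = complex_of_real (Re (a * u))" for u
  proof -
    have "cnj u / a = cnj (a * u)" using cnj_unit[OF assms] by simp
    then have "joukowski_linear a u = (a * u + cnj (a * u)) / 2" by (simp only: joukowski_linear_def)
    also have "\<dots> = complex_of_real (Re (a * u))" by (subst complex_add_cnj) (simp del: times_complex.sel)
    finally show ?thesis .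
  qed
  then have "\<alpha> + \<beta> * joukowski_linear a u = \<alpha> + Re (a * u) *\<^sub>R \<beta>" for u
    by (simp only: scaleR_conv_of_real mult.commute)
  then show ?thesis unfolding collinear_alt by blast
qed

section \<open>The regular polygon and its incircle\<close>

abbreviation unit_roots :: "nat \<Rightarrow> complex set" where
  "unit_roots n \<equiv> {u. u ^ n = 1}"

lemma cos_pi_div_pos: "n \<ge> 3 \<Longrightarrow> cos (pi / real n) > 0"
  by (intro cos_gt_zero) (simp_all add: pos_divide_less_eq)

lemma abs_cos_frac_le:
  assumes "k \<in> {1..<n}"
  shows "\<bar>cos (real k * pi / real n)\<bar> \<le> cos (pi / real n)"
proof -
  have "real k + 1 \<le> real n" using assms by auto
  then have "(real k + 1) * pi \<le> real n * pi" by (intro mult_right_mono) auto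
  then have le: "real k * pi / n \<le> pi - pi / n" using assms by (simp add: field_simps)
  have ge: "pi / n \<le> real k * pi / n" using assms by (simp add: field_simps)
  have pos: "0 \<le> pi / n" "pi / n \<le> pi" using assms by (simp_all add: field_simps)
  have "cos (real k * pi / n) \<le> cos (pi / n)"
    using ge le pos by (intro cos_monotone_0_pi_le) linarith+
  moreover have "cos (pi - pi / n) \<le> cos (real k * pi / n)"
    using ge le pos by (intro cos_monotone_0_pi_le) linarith+
  ultimately show ?thesis by simp
qed

lemma norm_unit_root: "n > 0 \<Longrightarrow> u \<in> unit_roots n \<Longrightarrow> norm u = 1"
  using power_eq_1_iff by blast

lemma finite_unit_roots: "n > 0 \<Longrightarrow> finite (unit_roots n)"
  using finite_roots_unity[of n] by auto

text \<open>The arguments of the roots of unity are spaced by \<open>2 * pi / n\<close>, so one lies within \<open>pi / n\<close> of \<open>t\<close>.\<close>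

lemma unit_root_near_direction:
  assumes "n > 0"
  obtains u where "u \<in> unit_roots n" "cis t \<bullet> u \<ge> cos (pi / n)"
proof
  define k where "k = round (t * n / (2 * pi))"
  define \<phi> where "\<phi> = 2 * pi * of_int k / n"
  have "\<bar>of_int k - t * n / (2 * pi)\<bar> \<le> 1 / 2"
    unfolding k_def using of_int_round_abs_le by blast
  moreover have "t - \<phi> = - (2 * pi / n) * (of_int k - t * n / (2 * pi))"
    using assms by (simp add: \<phi>_def field_simps)
  then have "\<bar>t - \<phi>\<bar> = (2 * pi / n) * \<bar>of_int k - t * n / (2 * pi)\<bar>"
    by (simp add: abs_mult)
  ultimately have "\<bar>t - \<phi>\<bar> \<le> (2 * pi / n) * (1 / 2)"
    by (metis mult_left_mono pi_ge_zero of_nat_0_le_iff divide_nonneg_nonneg zero_le_mult_iff zero_le_numeral)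
  then have le: "\<bar>t - \<phi>\<bar> \<le> pi / n" by simp
  show "cis \<phi> \<in> unit_roots n"
    using assms by (simp add: Complex.DeMoivre \<phi>_def cis_multiple_2pi)
  have "cis t \<bullet> cis \<phi> = cos \<bar>t - \<phi>\<bar>" by (simp add: inner_complex_def cos_diff)
  moreover have "cos (pi / n) \<le> cos \<bar>t - \<phi>\<bar>"
    using le assms by (intro cos_monotone_0_pi_le) (auto simp: divide_simps)
  ultimately show "cis t \<bullet> cis \<phi> \<ge> cos (pi / n)" by simp
qed

text \<open>By separation, a point outside the polygon would exceed every root of unity in some direction; but
  in each direction some root of unity reaches at least the inradius.\<close>

lemma cball_subset_convex_hull_unit_roots:
  assumes "n > 0"
  shows "cball 0 (cos (pi / n)) \<subseteq> convex hull (unit_roots n)"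
proof
  fix x :: complex assume x: "x \<in> cball 0 (cos (pi / n))"
  show "x \<in> convex hull (unit_roots n)"
  proof (rule ccontr)
    assume "x \<notin> convex hull (unit_roots n)"
    moreover have "closed (convex hull (unit_roots n))"
      using finite_unit_roots[OF assms]
      by (intro compact_imp_closed finite_imp_compact_convex_hull)
    ultimately obtain d b where d: "d \<bullet> x < b" "\<And>u. u \<in> convex hull (unit_roots n) \<Longrightarrow> b < d \<bullet> u"
      using separating_hyperplane_closed_point[of "convex hull (unit_roots n)" x] by auto
    define t where "t = Arg (- d)"
    have d_polar: "- d = norm d *\<^sub>R cis t"
      by (metis t_def rcis_cmod_Arg rcis_def norm_minus_cancel scaleR_conv_of_real)
    obtain u where u: "u \<in> unit_roots n" "cis t \<bullet> u \<ge> cos (pi / n)"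
      using unit_root_near_direction[OF assms] .
    have "d \<bullet> x < d \<bullet> u" using d(1) d(2)[OF hull_inc[OF u(1)]] by linarith
    then have "(- d) \<bullet> u < (- d) \<bullet> x" by simp
    then have "norm d * (cis t \<bullet> u) < norm d * (cis t \<bullet> x)" unfolding d_polar by simp
    then have "cis t \<bullet> u < cis t \<bullet> x" by (simp add: mult_less_cancel_left)
    also have "\<dots> \<le> norm x" using norm_cauchy_schwarz[of "cis t" x] by simp
    also have "\<dots> \<le> cos (pi / n)" using x by simp
    finally show False using u(2) by simp
  qed
qed

text \<open>The midpoint of the chord between two roots of unity whose arguments differ by \<open>2 * x\<close> has modulus
  \<open>\<bar>cos x\<bar>\<close>, which is largest for neighbouring roots.\<close>

lemma norm_sum_unit_roots_le:
  assumes "n \<ge> 2" "u \<in> unit_roots n" "v \<in> unit_roots n" "u \<noteq> v"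
  shows "norm (u + v) / 2 \<le> cos (pi / n)"
proof -
  have nz: "norm u = 1" "norm v = 1" using norm_unit_root[of n] assms by auto
  then have u0: "u \<noteq> 0" by auto
  have "(v / u) ^ n = 1" using assms by (simp add: power_divide)
  then have "v / u \<in> (\<lambda>k. cis (2 * pi * real k / real n)) ` {..<n}"
    using Complex.bij_betw_roots_unity[of n] assms by (auto simp: bij_betw_def)
  then obtain k where k: "k < n" "v / u = cis (2 * pi * real k / real n)" by auto
  then have k0: "k \<noteq> 0" using assms u0 by (auto intro!: Nat.gr0I)
  define x where "x = real k * pi / real n"
  have "norm (u + v) = norm (u * (1 + v / u))" using u0 by (simp add: distrib_left)
  also have "1 + v / u = 2 * cos x * cis x"
  proof -
    have "1 + v / u = 1 + cis (2 * x)" using k by (simp add: x_def mult_ac)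
    also have "\<dots> = 2 * cos x * cis x"
      by (simp add: complex_eq_iff cos_double_cos sin_double power2_eq_square)
    finally show ?thesis .
  qed
  finally have norm_uv: "norm (u + v) / 2 = \<bar>cos x\<bar>" using nz by (simp add: norm_mult)
  show ?thesis using norm_uv abs_cos_frac_le[of k n] k k0 by (simp add: x_def)
qed

text \<open>The direction of a chord is that of the tangent to the concentric circle through its midpoint.\<close>

lemma chord_orthogonal_midpoint:
  assumes "norm u = 1" "norm v = 1" "u + v \<noteq> 0"
  obtains t :: real where "v - u = t *\<^sub>R (\<i> * ((u + v) / 2))"
proof
  define q where "q = (v - u) / (u + v)"
  have "u \<noteq> 0" "v \<noteq> 0" "cnj u = 1 / u" "cnj v = 1 / v" using assms cnj_unit by auto
  then have "cnj q = (1 / v - 1 / u) / (1 / u + 1 / v)" by (simp add: q_def)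
  also have "1 / v - 1 / u = - (v - u) / (u * v)"
    using \<open>u \<noteq> 0\<close> \<open>v \<noteq> 0\<close> by (simp add: field_simps)
  also have "1 / u + 1 / v = (u + v) / (u * v)"
    using \<open>u \<noteq> 0\<close> \<open>v \<noteq> 0\<close> by (simp add: field_simps)
  also have "- (v - u) / (u * v) / ((u + v) / (u * v)) = - q"
    using \<open>u \<noteq> 0\<close> \<open>v \<noteq> 0\<close> by (simp add: q_def minus_divide_left)
  finally have "q = \<i> * Im q" by (simp add: complex_eq_iff)
  moreover have "v - u = q * (u + v)" using assms(3) by (simp add: q_def)
  ultimately have "v - u = (\<i> * Im q) * (u + v)" by simp
  then show "v - u = (2 * Im q) *\<^sub>R (\<i> * ((u + v) / 2))"
    by (simp add: scaleR_conv_of_real mult_ac)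
qed

section \<open>Affine images of the regular polygon\<close>

text \<open>Points of the unit circle are extreme in the disc by strict convexity, hence in any hull that they
  span, and an injective affine map preserves this.\<close>

lemma extreme_points_affine_image:
  fixes L :: "complex \<Rightarrow> complex"
  assumes L: "linear L" "inj L" and U: "U \<subseteq> sphere 0 1"
  shows "{z. z extreme_point_of convex hull ((\<lambda>u. c + L u) ` U)} = (\<lambda>u. c + L u) ` U"
proof (intro equalityI subsetI)
  fix z assume "z \<in> (\<lambda>u. c + L u) ` U"
  then obtain u where u: "u \<in> U" "z = c + L u" by auto
  have sub: "convex hull U \<subseteq> cball 0 1" using U by (intro hull_minimal) auto
  have "norm u = 1" using U u(1) by auto
  then have "u extreme_point_of convex hull U"
    using sub u(1) dist_decreases_open_segment[of u _ _ 0]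
    by (fastforce simp: extreme_point_of_def hull_inc)
  then have "L u extreme_point_of L ` (convex hull U)"
    using face_of_linear_image[OF L, of "{u}" "convex hull U"] by (simp flip: face_of_singleton)
  then have "c + L u extreme_point_of (+) c ` L ` (convex hull U)"
    by (simp only: extreme_point_of_translation_eq)
  then show "z \<in> {z. z extreme_point_of convex hull ((\<lambda>u. c + L u) ` U)}"
    using L(1) by (simp add: u convex_hull_linear_image image_image
      flip: convex_hull_translation)
qed (use extreme_point_of_convex_hull in auto)

lemma affine_image_open:
  fixes L :: "complex \<Rightarrow> complex"
  assumes "linear L" "inj L" "open S"
  shows "open ((\<lambda>u. c + L u) ` S)"
proof -
  have "open (L ` S)"
    using assms linear_injective_imp_surjective[of L] by (intro open_surjective_linear_image) auto
  then show ?thesis using open_translation[of "L ` S" c] by (simp add: image_image)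
qed

text \<open>Sides need not be matched with pairs of neighbouring roots of unity. The endpoints of a side come
  from distinct roots of unity, so their midpoint comes from a point \<open>m\<close> of modulus at most the inradius.
  If the modulus were smaller, the side would meet the interior of the polygon, which no proper face
  does, and the side is proper because the vertices are not collinear. So \<open>m\<close> lies on the incircle, and the affine map carries the tangent there, which is the
  chord, to the side.\<close>

lemma midpoint_inscribed_affine_image:
  fixes L :: "complex \<Rightarrow> complex" and n :: nat and c :: complex
  assumes L: "linear L" "inj L" and n: "n \<ge> 3"
  defines "F \<equiv> \<lambda>u. c + L u"
  assumes noncoll: "\<not> collinear (F ` unit_roots n)"
  shows "midpoint_inscribed (F ` sphere 0 (cos (pi / n))) (convex hull (F ` unit_roots n))"
proof -
  define r where "r = cos (pi / n)"
  define P where "P = convex hull (F ` unit_roots n)"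
  have r0: "r > 0" using n by (simp add: r_def cos_pi_div_pos)
  have hull_F: "P = F ` (convex hull (unit_roots n))"
  proof -
    have "P = convex hull ((+) c ` L ` unit_roots n)" by (simp add: P_def F_def image_image)
    also have "\<dots> = (+) c ` L ` (convex hull (unit_roots n))"
      using L(1) by (simp only: convex_hull_translation convex_hull_linear_image)
    finally show ?thesis by (simp add: F_def image_image)
  qed
  have cball_P: "F ` cball 0 r \<subseteq> P"
    using cball_subset_convex_hull_unit_roots[of n] n by (auto simp: hull_F r_def)
  have F_mid: "midpoint (F u) (F v) = F ((u + v) / 2)" for u v
  proof -
    have "L ((1 / 2) *\<^sub>R (u + v)) = (1 / 2) *\<^sub>R (L u + L v)"
      by (simp only: linear_cmul[OF L(1)] linear_add[OF L(1)])
    then have "L ((u + v) / 2) = (L u + L v) / 2" by (simp add: scaleR_conv_of_real)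
    then show ?thesis by (simp add: F_def midpoint_def scaleR_conv_of_real add_divide_distrib)
  qed
  have "tangent_line_at (affine hull {a, b}) (F ` sphere 0 r) (midpoint a b)"
    if edge: "closed_segment a b edge_of P" for a b
  proof -
    have face: "closed_segment a b face_of P" and "aff_dim (closed_segment a b) = 1"
      using edge by (auto simp: edge_of_def)
    then have ab: "a \<noteq> b" by auto
    have "a extreme_point_of P" "b extreme_point_of P"
      using extreme_point_of_face[OF face] extreme_point_of_segment by blast+
    then obtain u v where u: "u \<in> unit_roots n" "a = F u" and v: "v \<in> unit_roots n" "b = F v"
      unfolding P_def using extreme_point_of_convex_hull by (metis (no_types, lifting) imageE)
    then have uv: "u \<noteq> v" using ab by auto
    have norms: "norm u = 1" "norm v = 1" using norm_unit_root[of n] n u v by auto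
    define m where "m = (u + v) / 2"
    have mid: "midpoint a b = F m" by (simp add: u v m_def F_mid)
    have "norm m \<ge> r"
    proof (rule ccontr)
      assume "\<not> norm m \<ge> r"
      then have "F m \<in> F ` ball 0 r" by auto
      moreover have "open (F ` ball 0 r)"
        unfolding F_def using L by (intro affine_image_open) auto
      moreover have "F ` ball 0 r \<subseteq> P" using cball_P by auto
      ultimately have "F m \<in> interior P" by (meson interiorI)
      moreover have "F m \<in> closed_segment a b" by (metis mid midpoint_in_closed_segment)
      ultimately have "closed_segment a b = P"
        using face_of_disjoint_interior[OF face] by auto
      moreover have "F ` unit_roots n \<subseteq> P" by (simp add: P_def hull_subset)
      ultimately show False using noncoll collinear_subset collinear_closed_segment by metis
    qed
    moreover have "norm m \<le> r"
      using norm_sum_unit_roots_le[of n u v] n u v uv by (simp add: m_def r_def norm_divide)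
    ultimately have m: "norm m = r" by simp
    then have "u + v \<noteq> 0" using r0 by (auto simp: m_def)
    then obtain t where t: "v - u = t *\<^sub>R (\<i> * m)"
      using chord_orthogonal_midpoint norms by (metis m_def)
    \<comment> \<open>On the incircle, the curve starts at \<open>m\<close> with velocity \<open>\<i> * m\<close>, which is parallel to the chord.\<close>
    define \<gamma> where "\<gamma> s = F (m * cis s)" for s
    have "bounded_linear L" using L(1) by (simp add: linear_conv_bounded_linear)
    moreover have "((\<lambda>s. m * cis s) has_vector_derivative \<i> * m) (at 0)"
      unfolding cis_conv_exp by (auto intro!: derivative_eq_intros
         has_vector_derivative_real_field simp: mult.commute)
    ultimately have "((\<lambda>s. L (m * cis s)) has_vector_derivative L (\<i> * m)) (at 0)"
      by (rule bounded_linear.has_vector_derivative)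
    then have "(\<gamma> has_vector_derivative L (\<i> * m)) (at 0)"
      using has_vector_derivative_add[OF has_vector_derivative_const] unfolding \<gamma>_def F_def by fastforce
    moreover have "range \<gamma> \<subseteq> F ` sphere 0 r" by (auto simp: \<gamma>_def norm_mult m)
    moreover have "\<gamma> 0 = midpoint a b" by (simp add: \<gamma>_def mid)
    moreover have "L (\<i> * m) \<noteq> 0"
    proof -
      have "\<i> * m \<noteq> 0" using m r0 by auto
      then show ?thesis using linear_injective_0[OF L(1)] L(2) by blast
    qed
    moreover have "affine hull {a, b} = range (\<lambda>s. midpoint a b + s *\<^sub>R L (\<i> * m))"
    proof -
      have ba: "b - a = t *\<^sub>R L (\<i> * m)"
      proof -
        have "b - a = L (v - u)" using L(1) by (simp add: u v F_def linear_diff)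
        then show ?thesis by (simp only: t linear_cmul[OF L(1)])
      qed
      then have t0: "t \<noteq> 0" using ab by auto
      have "affine hull {a, b} = range (\<lambda>s. a + s *\<^sub>R (b - a))" by (rule affine_hull_2_alt)
      also have "(\<lambda>s. a + s *\<^sub>R (b - a)) = (\<lambda>s. midpoint a b + s *\<^sub>R L (\<i> * m)) \<circ> (\<lambda>s. (s - 1 / 2) * t)"
      proof
        fix s
        have "midpoint a b = a + (1 / 2) *\<^sub>R (b - a)"
          by (simp add: midpoint_def scaleR_conv_of_real field_simps)
        then have "midpoint a b + ((s - 1 / 2) * t) *\<^sub>R L (\<i> * m) =
            a + (1 / 2) *\<^sub>R (b - a) + (s - 1 / 2) *\<^sub>R (b - a)"
          by (simp add: ba)
        also have "\<dots> = a + s *\<^sub>R (b - a)" by (simp add: add.assoc flip: scaleR_left_distrib)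
        finally show "a + s *\<^sub>R (b - a) = ((\<lambda>s. midpoint a b + s *\<^sub>R L (\<i> * m)) \<circ> (\<lambda>s. (s - 1 / 2) * t)) s"
          by simp
      qed
      also have "surj (\<lambda>s. (s - 1 / 2) * t)"
        using t0 by (intro surjI[where f = "\<lambda>y. y / t + 1 / 2"]) simp
      then have "range ((\<lambda>s. midpoint a b + s *\<^sub>R L (\<i> * m)) \<circ> (\<lambda>s. (s - 1 / 2) * t)) =
          range (\<lambda>s. midpoint a b + s *\<^sub>R L (\<i> * m))"
        by (simp only: image_comp[symmetric])
      finally show ?thesis .
    qed
    ultimately show ?thesis unfolding tangent_line_at_def by blast
  qed
  moreover have "F ` sphere 0 r \<subseteq> P" using cball_P by auto
  ultimately show ?thesis by (simp add: midpoint_inscribed_def P_def r_def)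
qed

section \<open>The critical points and the roots of the polynomial\<close>

lemma extreme_points_collinear_cos:
  assumes n: "n \<ge> 3" and S: "S = (\<lambda>k::nat. \<alpha> + \<beta> * complex_of_real (cos (real k * pi / real n))) ` {1..<n}"
  shows "{z. z extreme_point_of (convex hull S)} =
    {\<alpha> + \<beta> * complex_of_real (cos (pi / real n)), \<alpha> - \<beta> * complex_of_real (cos (pi / real n))}"
    (is "_ = {?f, ?g}")
proof -
  define r where "r = cos (pi / n)"
  have r0: "r > 0" using n by (simp add: r_def cos_pi_div_pos)
  have last: "cos (real (n - 1) * pi / n) = - r"
  proof -
    have "real (n - 1) * pi / n = pi - pi / n" using n by (simp add: field_simps of_nat_diff)
    then show ?thesis by (simp add: r_def)
  qed
  have fS: "?f \<in> S" unfolding S by (rule image_eqI[of _ _ 1]) (use n in auto)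
  have gS: "?g \<in> S" unfolding S by (rule image_eqI[of _ _ "n - 1"]) (use n last in \<open>auto simp: r_def\<close>)
  have "S \<subseteq> closed_segment ?f ?g"
  proof
    fix z assume "z \<in> S"
    then obtain k where k: "k \<in> {1..<n}" "z = \<alpha> + \<beta> * complex_of_real (cos (real k * pi / real n))"
      by (auto simp: S)
    define x where "x = cos (real k * pi / n)"
    have z: "z = \<alpha> + \<beta> * complex_of_real x" using k(2) by (simp add: x_def)
    have "\<bar>x\<bar> \<le> r" using abs_cos_frac_le[OF k(1)] by (simp add: x_def r_def)
    then show "z \<in> closed_segment ?f ?g"
      unfolding in_segment r_def[symmetric] z using r0
      by (intro exI[of _ "(1 - x / r) / 2"] conjI)
         (simp_all add: scaleR_conv_of_real field_simps)
  qed
  then have "convex hull S \<subseteq> closed_segment ?f ?g" by (intro hull_minimal) auto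
  moreover have "closed_segment ?f ?g \<subseteq> convex hull S"
    using fS gS by (simp add: closed_segment_subset_convex_hull hull_inc)
  ultimately have "convex hull S = closed_segment ?f ?g" by blast
  then show ?thesis by (auto simp: extreme_point_of_segment)
qed

text \<open>After the substitution \<open>z = \<alpha> + \<beta> * w\<close> the polynomial is \<open>c * T\<^sub>n + d\<close>, so its roots form a level set
  of \<open>T\<^sub>n\<close>.\<close>

lemma poly_roots_chebyshev_form:
  fixes p :: "complex poly"
  assumes n: "degree p = n" "n \<ge> 2" and b: "\<beta> \<noteq> 0"
    and crit: "critical_points p
           = (\<lambda>k::nat. \<alpha> + \<beta> * complex_of_real (cos (real k * pi / real n))) ` {1..<n}"
  obtains a where "a \<noteq> 0" "poly_roots p = (\<lambda>u. \<alpha> + \<beta> * joukowski_linear a u) ` unit_roots n"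
proof -
  define q where "q = pcompose p [:\<alpha>, \<beta>:]"
  have pd: "poly (pderiv q) w = \<beta> * poly (pderiv p) (\<alpha> + \<beta> * w)" for w
    by (simp add: q_def pderiv_pcompose poly_pcompose pderiv_pCons mult_ac)
  have degq: "degree q = n" using b n by (simp add: q_def degree_pcompose)
  then have deriv_nz: "pderiv q \<noteq> 0" using n by (simp add: pderiv_eq_0_iff)
  have deriv_zero: "poly (pderiv q) (complex_of_real (cos (real k * pi / real n))) = 0"
    if "k \<in> {1..<n}" for k
  proof -
    have "\<alpha> + \<beta> * complex_of_real (cos (real k * pi / real n)) \<in> critical_points p"
      using that crit by blast
    then show ?thesis by (simp add: pd critical_points_def poly_roots_def)
  qed
  obtain c d where cd: "c \<noteq> 0" "q = smult c (chebyshev n) + [:d:]"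
    using eq_chebyshev_if_same_critical_points[OF n(2) eq_imp_le[OF degq] deriv_nz deriv_zero] .
  obtain a where a: "a \<noteq> 0" "{w. poly (chebyshev n) w = - d / c} = joukowski_linear a ` unit_roots n"
    using chebyshev_level_set[of n "- d / c"] n by auto
  have "poly q w = 0 \<longleftrightarrow> w \<in> joukowski_linear a ` unit_roots n" for w
    unfolding a(2)[symmetric] using cd by (auto simp: field_simps add_eq_0_iff)
  then have root: "poly p (\<alpha> + \<beta> * w) = 0 \<longleftrightarrow> w \<in> joukowski_linear a ` unit_roots n" for w
    by (simp add: q_def poly_pcompose mult.commute[of \<beta>])
  have "poly_roots p = (\<lambda>w. \<alpha> + \<beta> * w) ` (joukowski_linear a ` unit_roots n)"
  proof (intro equalityI subsetI)
    fix z assume z: "z \<in> poly_roots p"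
    have "z = \<alpha> + \<beta> * ((z - \<alpha>) / \<beta>)" using b by simp
    moreover from this z have "(z - \<alpha>) / \<beta> \<in> joukowski_linear a ` unit_roots n"
      using root[of "(z - \<alpha>) / \<beta>"] by (simp add: poly_roots_def)
    ultimately show "z \<in> (\<lambda>w. \<alpha> + \<beta> * w) ` (joukowski_linear a ` unit_roots n)" by blast
  qed (use root in \<open>auto simp: poly_roots_def\<close>)
  then show thesis using a(1) by (intro that[of a]) (auto simp: image_image)
qed

theorem mainTheorem1:
  fixes p :: "complex poly" and n :: nat and \<alpha> \<beta> :: complex
  assumes "degree p = n"
    and "\<beta> \<noteq> 0"
    and "critical_points p
           = (\<lambda>k::nat. \<alpha> + \<beta> * complex_of_real (cos (real k * pi / real n))) ` {1..<n}"
    and "\<not> collinear (poly_roots p)"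
  defines "f \<equiv> \<alpha> + \<beta> * complex_of_real (cos (pi / real n))"
    and "g \<equiv> \<alpha> - \<beta> * complex_of_real (cos (pi / real n))"
  shows "\<exists>P E. convex_polygon_with_vertices P (poly_roots p)
           \<and> ellipse_with_foci E f g
           \<and> midpoint_inscribed E P
           \<and> f \<noteq> g
           \<and> {z. z extreme_point_of (convex hull critical_points p)} = {f, g}"
proof -
  \<comment> \<open>A constant polynomial has every point as a critical point, but \<open>{1..<0}\<close> is empty.\<close>
  have "n \<noteq> 0"
  proof
    assume "n = 0"
    then have "pderiv p = 0" using assms(1) by (simp add: pderiv_eq_0_iff)
    then show False using assms(3) \<open>n = 0\<close> by (auto simp: critical_points_def poly_roots_def)
  qed
  then have p0: "p \<noteq> 0" using assms(1) by auto
  then have fin: "finite (poly_roots p)" unfolding poly_roots_def by (rule poly_roots_finite)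
  have n: "n \<ge> 3"
  proof (rule ccontr)
    assume "\<not> n \<ge> 3"
    then have "card (poly_roots p) \<le> 2"
      using card_poly_roots_bound[OF p0] assms(1) by (simp add: poly_roots_def)
    then show False using collinear_small[OF fin] assms(4) by simp
  qed
  define r where "r = cos (pi / n)"
  have r0: "r > 0" using n by (simp add: r_def cos_pi_div_pos)
  obtain a where a: "a \<noteq> 0" and roots: "poly_roots p = (\<lambda>u. \<alpha> + \<beta> * joukowski_linear a u) ` unit_roots n"
    using poly_roots_chebyshev_form[OF assms(1) _ assms(2,3)] n by auto
  have U: "unit_roots n \<subseteq> sphere 0 1"
    using norm_unit_root[of n] n by auto
  have a1: "norm a \<noteq> 1" using collinear_joukowski_linear_unit assms(4) by (auto simp: roots)
  note L = linear_joukowski_linear[of \<beta> a] inj_joukowski_linear[OF a assms(2) a1]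
  define E where "E = (\<lambda>u. \<alpha> + \<beta> * joukowski_linear a u) ` sphere 0 r"
  have "convex_polygon_with_vertices (convex hull poly_roots p) (poly_roots p)"
    unfolding convex_polygon_with_vertices_def
    using fin assms(4) extreme_points_affine_image[OF L U, of \<alpha>] by (simp add: roots)
  moreover have "ellipse_with_foci E f g"
    using ellipse_joukowski_linear[OF a a1 assms(2) r0, of \<alpha>] by (simp add: E_def f_def g_def r_def)
  moreover have "midpoint_inscribed E (convex hull poly_roots p)"
    using midpoint_inscribed_affine_image[OF L n, of \<alpha>] assms(4) by (simp add: roots E_def r_def)
  moreover have "f \<noteq> g"
    using r0 assms(2) by (simp add: f_def g_def flip: r_def)
  moreover have "{z. z extreme_point_of (convex hull critical_points p)} = {f, g}"
    using extreme_points_collinear_cos[OF _ assms(3)] n by (simp add: f_def g_def)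
  ultimately show ?thesis by blast
qed

end
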